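(* There are $\mathfrak{c}$ many pairwise non-isomorphic ideals of the form $\mathcal{Z}_g$ with $g\in G$.
   Context: $\omega=\{0,1,2,\ldots\}$ and $n\in\omega$ is identified with $\{0,\ldots,n-1\}$. $G$ is the set of all functions $g\colon\omega\to(0,\infty)$ such that $g(n)\to\infty$ and $\frac{n}{g(n)}\not\to 0$. For $g\in G$, $\mathcal{Z}_g=\{A\subseteq\omega:\ \lim_{n\to\infty}\frac{\mathrm{card}(A\cap n)}{g(n)}=0\}$, which is an ideal on $\omega$. Ideals $\mathcal{I},\mathcal{J}$ on $\omega$ are isomorphic if there is a bijection $\phi\colon\omega\to\omega$ such that for all $A\subseteq\omega$, $A\in\mathcal{I}\iff\phi^{-1}[A]\in\mathcal{J}$. $\mathfrak{c}$ is the cardinality of the continuum. *)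

theory Defs
  imports Complex_Main "HOL-Library.Equipollence"
begin

definition ideal_on_nat :: "nat set set \<Rightarrow> bool" where
  "ideal_on_nat \<I> \<longleftrightarrow>
     (\<forall>A B. B \<in> \<I> \<longrightarrow> A \<subseteq> B \<longrightarrow> A \<in> \<I>) \<and>
     (\<forall>A B. A \<in> \<I> \<longrightarrow> B \<in> \<I> \<longrightarrow> A \<union> B \<in> \<I>) \<and>
     (\<forall>A. finite A \<longrightarrow> A \<in> \<I>) \<and>
     UNIV \<notin> \<I>"

definition weight_functions :: "(nat \<Rightarrow> real) set" where
  "weight_functions = {g. (\<forall>n. g n > 0) \<and> filterlim g at_top sequentially \<and>
     \<not> (\<lambda>n. real n / g n) \<longlonglongrightarrow> 0}"

text \<open>The von Neumann natural number \<open>n\<close> is the set \<open>{..<n}\<close>.\<close>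

definition density_ideal :: "(nat \<Rightarrow> real) \<Rightarrow> nat set set" where
  "density_ideal g = {A. (\<lambda>n. real (card (A \<inter> {..<n})) / g n) \<longlonglongrightarrow> 0}"

definition isomorphic_ideals :: "nat set set \<Rightarrow> nat set set \<Rightarrow> bool" where
  "isomorphic_ideals \<I> \<J> \<longleftrightarrow>
     (\<exists>\<phi>. bij \<phi> \<and> (\<forall>A. A \<in> \<I> \<longleftrightarrow> \<phi> -` A \<in> \<J>))"

lemma ideal_on_nat_density_ideal:
  assumes "g \<in> weight_functions"
  shows "ideal_on_nat (density_ideal g)"
proof -
  have pos: "\<And>n. g n > 0"
    and lim: "filterlim g at_top sequentially"
    and nlim: "\<not> (\<lambda>n. real n / g n) \<longlonglongrightarrow> 0"
    using assms by (auto simp: weight_functions_def)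
  have dominated: "(\<lambda>n. a n / g n) \<longlonglongrightarrow> 0"
    if "\<And>n. 0 \<le> a n" "\<And>n. a n \<le> b n" "(\<lambda>n. b n / g n) \<longlonglongrightarrow> 0"
    for a b :: "nat \<Rightarrow> real"
  proof (rule tendsto_sandwich[OF _ _ tendsto_const that(3)])
    show "\<forall>\<^sub>F n in sequentially. 0 \<le> a n / g n"
      using that(1) pos by (auto simp: less_imp_le)
    show "\<forall>\<^sub>F n in sequentially. a n / g n \<le> b n / g n"
      using that(2) pos by (intro always_eventually allI divide_right_mono) (auto simp: less_imp_le)
  qed
  have "A \<in> density_ideal g" if "B \<in> density_ideal g" "A \<subseteq> B" for A B
    using that(1) unfolding density_ideal_def mem_Collect_eq
    by (rule dominated[rotated 2]) (use that(2) in \<open>auto intro!: card_mono\<close>)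
  moreover have "A \<union> B \<in> density_ideal g"
    if "A \<in> density_ideal g" "B \<in> density_ideal g" for A B
  proof -
    have "(\<lambda>n. (real (card (A \<inter> {..<n})) + real (card (B \<inter> {..<n}))) / g n) \<longlonglongrightarrow> 0"
      using tendsto_add[of _ 0 _ _ 0] that by (simp add: density_ideal_def add_divide_distrib)
    then show ?thesis
      unfolding density_ideal_def mem_Collect_eq
    proof (rule dominated[rotated 2])
      show "real (card ((A \<union> B) \<inter> {..<n}))
          \<le> real (card (A \<inter> {..<n})) + real (card (B \<inter> {..<n}))" for n
        using card_Un_le[of "A \<inter> {..<n}" "B \<inter> {..<n}"]
        by (simp add: Int_Un_distrib2 flip: of_nat_add)
    qed simp
  qed
  moreover have "A \<in> density_ideal g" if "finite A" for A
  proof -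
    have "(\<lambda>n. real (card A) / g n) \<longlonglongrightarrow> 0"
      by (rule real_tendsto_divide_at_top[OF tendsto_const lim])
    then show ?thesis
      unfolding density_ideal_def mem_Collect_eq
      by (rule dominated[rotated 2]) (use that in \<open>auto intro!: card_mono\<close>)
  qed
  moreover have "UNIV \<notin> density_ideal g"
    using nlim by (simp add: density_ideal_def)
  ultimately show ?thesis
    unfolding ideal_on_nat_def by blast
qed

end

theory Submission
  imports Defs "HOL-Library.Nat_Bijection"
begin

text \<open>
  For an infinite set \<open>S\<close> choose a weight \<open>g\<close> for which only the positions \<open>(k+1)!\<close>, \<open>k \<in> S\<close>,
  matter: \<open>A \<in> \<Z>\<^sub>g\<close> says that the density of \<open>A\<close> below \<open>(k+1)!\<close> tends to \<open>0\<close> along \<open>S\<close>.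
  Suppose \<open>\<phi>\<close> is an isomorphism between the ideals of \<open>S\<close> and \<open>T\<close>, with \<open>S - T\<close> infinite. For
  \<open>k \<in> S - T\<close> discard from \<open>{..<(k+1)!}\<close> the \<open>\<phi>\<close>-image of \<open>{..<k!}\<close>; the rest still has density
  close to \<open>1\<close>. Its preimage has at most \<open>(k+1)!\<close> elements, all at least \<open>k!\<close>, so it is
  negligible below \<open>(j+1)!\<close> for \<open>j > k\<close> and invisible there for \<open>j < k\<close>, while \<open>j = k\<close> does not
  lie in \<open>T\<close>. Hence the union of the preimages belongs to the ideal of \<open>T\<close>, whereas the union of
  the sets does not belong to the ideal of \<open>S\<close>. The graphs of \<open>n \<mapsto> \<lfloor>x n\<rfloor>\<close>, for real \<open>x\<close>, are
  continuum many infinite sets with infinite pairwise differences.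
\<close>

text \<open>Away from the chosen positions the weight is quadratic, so
  \<open>card (A \<inter> {..<n}) \<le> n\<close> makes the quotient vanish for every
  \<open>A\<close>. The \<open>+ 1\<close> keeps the weight positive at \<open>0\<close>.\<close>

definition sparse_weight :: "nat set \<Rightarrow> nat \<Rightarrow> real" where
  "sparse_weight S n = (if n \<in> (\<lambda>k. fact (Suc k)) ` S then real n else (real n)\<^sup>2 + 1)"

lemma sparse_weight_fact:
  "k \<in> S \<Longrightarrow> sparse_weight S (fact (Suc k)) = fact (Suc k)"
  unfolding sparse_weight_def by (subst if_P) (auto simp del: fact_Suc)

lemma sparse_weight_pos: "sparse_weight S n > 0"
  by (auto simp: sparse_weight_def add_nonneg_pos simp del: fact_Suc)

lemma sparse_weight_ge: "sparse_weight S n \<ge> real n"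
proof -
  have "real n \<le> (real n)\<^sup>2 + 1"
    using zero_le_power2[of "real n - 1"] by (simp add: power2_diff)
  then show ?thesis
    by (simp add: sparse_weight_def del: fact_Suc)
qed

lemma filterlim_fact_Suc: "filterlim (\<lambda>k. fact (Suc k) :: nat) at_top sequentially"
  by (rule filterlim_at_top_mono[OF filterlim_Suc])
    (auto intro!: always_eventually fact_ge_self simp del: fact_Suc)

lemma density_ideal_sparse_weightD:
  assumes "A \<in> density_ideal (sparse_weight S)" and "e > 0"
  shows "\<forall>\<^sub>F k in sequentially. k \<in> S \<longrightarrow> real (card (A \<inter> {..<fact (Suc k)})) < e * fact (Suc k)"
proof -
  have "\<forall>\<^sub>F n in sequentially. real (card (A \<inter> {..<n})) / sparse_weight S n < e"
    using assms by (auto simp: density_ideal_def intro: order_tendstoD)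
  from filterlim_fact_Suc[THEN filterlim_iff[THEN iffD1], rule_format, OF this]
  show ?thesis
    by (rule eventually_mono)
      (auto simp: sparse_weight_fact divide_less_eq simp del: fact_Suc)
qed

lemma sparse_weight_in_weight_functions:
  assumes "infinite S"
  shows "sparse_weight S \<in> weight_functions"
proof -
  have "filterlim (sparse_weight S) at_top sequentially"
    by (rule filterlim_at_top_mono[OF filterlim_real_sequentially])
      (simp add: sparse_weight_ge)
  \<comment> \<open>This is the third condition on weights: \<open>n / g n\<close> equals
    \<open>1\<close> at each of the infinitely many positions \<open>fact (Suc k)\<close> with
    \<open>k \<in> S\<close>.\<close>
  moreover have "UNIV \<notin> density_ideal (sparse_weight S)"
  proof
    assume "UNIV \<in> density_ideal (sparse_weight S)"
    from density_ideal_sparse_weightD[OF this, of 1]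
    have "\<forall>\<^sub>F k in sequentially. k \<notin> S"
      by (simp del: fact_Suc)
    then show False
      using assms by (simp add: cofinite_eq_sequentially[symmetric] eventually_cofinite)
  qed
  ultimately show ?thesis
    by (auto simp: weight_functions_def density_ideal_def sparse_weight_pos)
qed

text \<open>Since \<open>c\<close> does not depend on \<open>k\<close>, the quotient at
  \<open>fact (Suc k)\<close> is at most \<open>c / (k + 1)\<close>. Other positions are harmless
  because of the quadratic weight.\<close>

lemma density_ideal_sparse_weightI:
  assumes le: "\<And>k. k \<in> S \<Longrightarrow> card (A \<inter> {..<fact (Suc k)}) \<le> c * fact k"
  shows "A \<in> density_ideal (sparse_weight S)"
  unfolding density_ideal_def mem_Collect_eq
proof (rule order_tendstoI)
  fix e :: real
  assume "e < 0"
  moreover have "0 \<le> real (card (A \<inter> {..<n})) / sparse_weight S n" for n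
    using sparse_weight_pos[of S n] by simp
  ultimately show "\<forall>\<^sub>F n in sequentially. e < real (card (A \<inter> {..<n})) / sparse_weight S n"
    by (intro always_eventually allI) (rule less_le_trans)
next
  fix e :: real
  assume "0 < e"
  obtain K :: nat where K: "real c / e < real K"
    using reals_Archimedean2 by blast
  obtain N :: nat where N: "1 / e < real N"
    using reals_Archimedean2 by blast
  \<comment> \<open>The bound \<open>fact (Suc K)\<close> serves the chosen positions, forcing
    \<open>K \<le> k\<close>; the bound \<open>Suc N\<close> serves the others, where
    \<open>1 < e * n\<close>.\<close>
  have "real (card (A \<inter> {..<n})) / sparse_weight S n < e" if n: "n \<ge> max (Suc N) (fact (Suc K))" for n
  proof (cases "n \<in> (\<lambda>k. fact (Suc k)) ` S")
    case True
    then obtain k where k: "k \<in> S" "n = fact (Suc k)" by blast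
    have "K \<le> k"
    proof (rule ccontr)
      assume "\<not> K \<le> k"
      then have "(fact (Suc k) :: nat) < fact (Suc K)"
        by (intro fact_less_mono) auto
      with n k show False by linarith
    qed
    then have "real c / e < real (Suc k)"
      using K by linarith
    then have "real c < e * real (Suc k)"
      using \<open>0 < e\<close> by (simp only: divide_less_eq mult.commute if_True)
    then have "real c * fact k < e * real (Suc k) * fact k"
      by (intro mult_strict_right_mono) auto
    moreover have "real (card (A \<inter> {..<n})) \<le> real (c * fact k)"
      using le[OF k(1)] k(2) by (simp only: of_nat_le_iff)
    moreover have "real (c * fact k) = real c * fact k" and "e * real (Suc k) * fact k = e * real n"
      unfolding k(2) by (simp_all add: algebra_simps)
    ultimately have "real (card (A \<inter> {..<n})) < e * real n"
      by linarith
    moreover have "sparse_weight S n = real n"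
      using True by (simp add: sparse_weight_def del: fact_Suc)
    ultimately show ?thesis
      using k(2) by (simp add: divide_less_eq del: fact_Suc)
  next
    case False
    have "N < n"
      using n by simp
    then have "1 / e < real n"
      using N by linarith
    then have "1 < e * real n"
      using \<open>0 < e\<close> by (simp only: divide_less_eq mult.commute if_True)
    then have "real n < e * (real n)\<^sup>2"
      using mult_strict_right_mono[of 1 "e * real n" "real n"] n
      by (simp add: power2_eq_square mult.assoc)
    moreover have "card (A \<inter> {..<n}) \<le> n"
      using card_mono[of "{..<n}" "A \<inter> {..<n}"] by simp
    ultimately have "real (card (A \<inter> {..<n})) < e * ((real n)\<^sup>2 + 1)"
      using \<open>0 < e\<close> by (simp add: distrib_left)
    then show ?thesis
      using False by (simp add: sparse_weight_def divide_less_eq add_nonneg_pos del: fact_Suc)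
  qed
  then show "\<forall>\<^sub>F n in sequentially. real (card (A \<inter> {..<n})) / sparse_weight S n < e"
    unfolding eventually_sequentially by blast
qed

text \<open>The last term dominates: \<open>2 * fact k \<le> fact (Suc k)\<close> carries the
  induction, but fails at \<open>k = 0\<close>.\<close>

lemma sum_fact_Suc_le: "(\<Sum>i<k. fact (Suc i)) \<le> (2 * fact k :: nat)"
proof (induction k)
  case (Suc k)
  show ?case
  proof (cases "k = 0")
    case False
    then have "2 * fact k \<le> (fact (Suc k) :: nat)"
      unfolding fact_Suc of_nat_id by (intro mult_right_mono) auto
    with Suc show ?thesis
      by (simp del: fact_Suc)
  qed simp
qed simp

lemma not_isomorphic_sparse_weight:
  assumes "infinite (S - T)"
  shows "\<not> isomorphic_ideals (density_ideal (sparse_weight S)) (density_ideal (sparse_weight T))"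
proof
  assume "isomorphic_ideals (density_ideal (sparse_weight S)) (density_ideal (sparse_weight T))"
  then obtain \<phi> :: "nat \<Rightarrow> nat" where \<phi>: "bij \<phi>" and
    iso: "\<And>A. A \<in> density_ideal (sparse_weight S) \<longleftrightarrow> \<phi> -` A \<in> density_ideal (sparse_weight T)"
    unfolding isomorphic_ideals_def by blast
  define E where "E = (\<Union>k\<in>S - T. {m. \<phi> m < fact (Suc k) \<and> fact k \<le> m})"
  have vimage: "\<phi> -` (\<phi> ` E) = E"
    using \<phi> by (simp add: inj_vimage_image_eq bij_is_inj)
  have card_below: "card (\<phi> -` {..<n}) = n" "finite (\<phi> -` {..<n})" for n
    using \<phi> by (auto simp: card_vimage_inj bij_is_inj bij_is_surj intro: finite_vimageI)
  have "E \<in> density_ideal (sparse_weight T)"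
  proof (rule density_ideal_sparse_weightI)
    fix j
    assume "j \<in> T"
    \<comment> \<open>Blocks with \<open>k > j\<close> start at
      \<open>fact k \<ge> fact (Suc j)\<close>, and \<open>k = j\<close> is impossible as
      \<open>j \<in> T\<close>.\<close>
    have "E \<inter> {..<fact (Suc j)} \<subseteq> (\<Union>k<j. \<phi> -` {..<fact (Suc k)})"
    proof
      fix m
      assume "m \<in> E \<inter> {..<fact (Suc j)}"
      then obtain k where k: "k \<in> S - T" "\<phi> m < fact (Suc k)" "fact k \<le> m" "m < fact (Suc j)"
        by (auto simp: E_def simp del: fact_Suc)
      have "k < Suc j"
      proof (rule ccontr)
        assume "\<not> k < Suc j"
        then have "fact (Suc j) \<le> (fact k :: nat)"
          by (intro fact_mono_nat) simp
        with k show False by linarith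
      qed
      moreover have "k \<noteq> j"
        using k \<open>j \<in> T\<close> by blast
      ultimately show "m \<in> (\<Union>k<j. \<phi> -` {..<fact (Suc k)})"
        using k(2) by (auto simp del: fact_Suc)
    qed
    then have "card (E \<inter> {..<fact (Suc j)}) \<le> card (\<Union>k<j. \<phi> -` {..<fact (Suc k)})"
      by (intro card_mono finite_UN_I) (auto simp: card_below simp del: fact_Suc)
    also have "\<dots> \<le> (\<Sum>k<j. card (\<phi> -` {..<fact (Suc k)}))"
      by (intro card_UN_le) simp
    also have "\<dots> \<le> 2 * fact j"
      using sum_fact_Suc_le by (simp add: card_below del: fact_Suc)
    finally show "card (E \<inter> {..<fact (Suc j)}) \<le> 2 * fact j" .
  qed
  then have "\<phi> ` E \<in> density_ideal (sparse_weight S)"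
    using iso vimage by simp
  from density_ideal_sparse_weightD[OF this, of "1/2"]
  have "finite {k. \<not> (k \<in> S \<longrightarrow> real (card (\<phi> ` E \<inter> {..<fact (Suc k)})) < 1/2 * fact (Suc k))}"
    (is "finite ?B")
    by (simp add: cofinite_eq_sequentially[symmetric] eventually_cofinite del: fact_Suc)
  \<comment> \<open>Excluding \<open>0\<close> gives \<open>2 * fact k \<le> fact (Suc k)\<close>,
    so removing \<open>fact k\<close> points leaves at least half of
    \<open>{..<fact (Suc k)}\<close>, contradicting the bound with \<open>1/2\<close>.\<close>
  then have "infinite (S - T - insert 0 ?B)"
    by (intro Diff_infinite_finite[OF _ assms]) simp
  from infinite_imp_nonempty[OF this]
  obtain k where k: "k \<in> S - T" "k \<noteq> 0"
    and less: "real (card (\<phi> ` E \<inter> {..<fact (Suc k)})) < 1/2 * fact (Suc k)"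
    by blast
  have "{..<fact (Suc k)} - \<phi> ` {..<fact k} \<subseteq> \<phi> ` E \<inter> {..<fact (Suc k)}"
  proof
    fix i
    assume i: "i \<in> {..<fact (Suc k)} - \<phi> ` {..<fact k}"
    obtain m where "i = \<phi> m"
      using \<phi> by (metis bij_pointE)
    with i k show "i \<in> \<phi> ` E \<inter> {..<fact (Suc k)}"
      by (auto simp: E_def not_less[symmetric] simp del: fact_Suc)
  qed
  then have "card ({..<fact (Suc k)} - \<phi> ` {..<fact k}) \<le> card (\<phi> ` E \<inter> {..<fact (Suc k)})"
    by (intro card_mono) auto
  moreover have "fact (Suc k) - fact k \<le> card ({..<fact (Suc k)} - \<phi> ` {..<fact k})"
    using diff_card_le_card_Diff[of "\<phi> ` {..<fact k}" "{..<fact (Suc k)}"]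
      card_image[OF inj_on_subset[OF bij_is_inj[OF \<phi>] subset_UNIV], of "{..<fact k}"]
    by (simp del: fact_Suc)
  moreover have "2 * fact k \<le> (fact (Suc k) :: nat)"
    unfolding fact_Suc of_nat_id by (intro mult_right_mono) (use k in auto)
  ultimately have "fact (Suc k) \<le> 2 * card (\<phi> ` E \<inter> {..<fact (Suc k)})"
    by linarith
  then have "real (fact (Suc k)) \<le> real (2 * card (\<phi> ` E \<inter> {..<fact (Suc k)}))"
    by (simp only: of_nat_le_iff)
  with less show False
    by (simp del: fact_Suc)
qed

definition slope_set :: "real \<Rightarrow> nat set" where
  "slope_set x = range (\<lambda>n. prod_encode (n, int_encode \<lfloor>x * real n\<rfloor>))"

lemma infinite_slope_set: "infinite (slope_set x)"
  unfolding slope_set_def by (intro range_inj_infinite injI) simp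

text \<open>The gap between \<open>x * n\<close> and \<open>y * n\<close> grows linearly, so the
  floors differ from some \<open>n\<close> on and the graphs share only finitely many
  points.\<close>

lemma infinite_slope_set_Diff:
  assumes "x \<noteq> y"
  shows "infinite (slope_set x - slope_set y)"
proof -
  obtain N :: nat where N: "1 / \<bar>x - y\<bar> < real N"
    using reals_Archimedean2 by blast
  have "\<lfloor>x * real n\<rfloor> \<noteq> \<lfloor>y * real n\<rfloor>" if "n \<ge> N" for n
  proof
    assume "\<lfloor>x * real n\<rfloor> = \<lfloor>y * real n\<rfloor>"
    then have "\<bar>x * real n - y * real n\<bar> < 1"
      by linarith
    then have "\<bar>x - y\<bar> * real n < 1"
      by (simp add: abs_mult flip: left_diff_distrib)
    moreover have "1 < \<bar>x - y\<bar> * real N"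
      using N assms by (simp add: divide_less_eq mult.commute)
    moreover have "\<bar>x - y\<bar> * real N \<le> \<bar>x - y\<bar> * real n"
      using that by (intro mult_left_mono) auto
    ultimately show False by linarith
  qed
  then have "(\<lambda>n. prod_encode (n, int_encode \<lfloor>x * real n\<rfloor>)) ` {N..} \<subseteq> slope_set x - slope_set y"
    by (auto simp: slope_set_def int_encode_eq)
  \<comment> \<open>The first component of the pair makes the map injective.\<close>
  moreover have "infinite ((\<lambda>n. prod_encode (n, int_encode \<lfloor>x * real n\<rfloor>)) ` {N..})"
    by (subst finite_image_iff) (auto intro: inj_onI simp: infinite_Ici)
  ultimately show ?thesis
    by (rule infinite_super)
qed

lemma isomorphic_ideals_refl: "isomorphic_ideals \<I> \<I>"
  unfolding isomorphic_ideals_def by (intro exI[of _ id]) simp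

theorem corollary2:
  "\<exists>S. S \<subseteq> density_ideal ` weight_functions \<and> S \<approx> (UNIV :: real set) \<and>
     pairwise (\<lambda>\<I> \<J>. \<not> isomorphic_ideals \<I> \<J>) S"
proof -
  define Z where "Z x = density_ideal (sparse_weight (slope_set x))" for x
  have not_iso: "\<not> isomorphic_ideals (Z x) (Z y)" if "x \<noteq> y" for x y
    unfolding Z_def by (intro not_isomorphic_sparse_weight infinite_slope_set_Diff that)
  \<comment> \<open>Equal ideals are isomorphic via \<open>id\<close>, so distinct reals give
    distinct ideals.\<close>
  have "inj Z"
    using not_iso isomorphic_ideals_refl by (metis injI)
  show ?thesis
  proof (intro exI[of _ "range Z"] conjI)
    show "range Z \<subseteq> density_ideal ` weight_functions"
      by (auto simp: Z_def intro!: imageI sparse_weight_in_weight_functions infinite_slope_set)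
    show "range Z \<approx> (UNIV :: real set)"
      using \<open>inj Z\<close> by (rule inj_on_image_eqpoll_self)
    show "pairwise (\<lambda>\<I> \<J>. \<not> isomorphic_ideals \<I> \<J>) (range Z)"
      by (rule pairwiseI) (metis not_iso imageE)
  qed
qed

end
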